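(* Let $H(X,Y,E)$ be a complete bipartite $r$-uniform hypergraph with $|X|=|Y|=r$. Then the total edge-domatic number of $H$ is $ed_t(H)=|E|/2$.
   Context: A hypergraph has a finite vertex set and a set of hyperedges, each a subset of the vertex set; it is $r$-uniform if every hyperedge has exactly $r$ vertices. A complete bipartite $r$-uniform hypergraph $H(X,Y,E)$ ($r\ge 2$) has vertex set $X\cup Y$ with $X,Y$ disjoint and nonempty, and its hyperedges are all $r$-element subsets of $X\cup Y$ containing at least one vertex of $X$ and at least one vertex of $Y$. Two distinct hyperedges are adjacent if they share at least one vertex; a hyperedge is not adjacent to itself. A total edge-dominating set is a subset $E_t\subseteq E$ such that every hyperedge in $E$ is adjacent to some hyperedge in $E_t$. The total edge-domatic number $ed_t(H)$ is the maximum number of classes in a partition of $E$ into total edge-dominating sets. *)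

theory Defs
  imports Complex_Main "HOL-Library.Disjoint_Sets"
begin

definition hypergraph :: "'a set \<Rightarrow> 'a set set \<Rightarrow> bool" where
  "hypergraph V E \<longleftrightarrow> finite V \<and> (\<forall>e\<in>E. e \<subseteq> V)"

definition uniform :: "nat \<Rightarrow> 'a set set \<Rightarrow> bool" where
  "uniform r E \<longleftrightarrow> (\<forall>e\<in>E. card e = r)"

definition complete_bipartite_hypergraph ::
    "nat \<Rightarrow> 'a set \<Rightarrow> 'a set \<Rightarrow> 'a set set \<Rightarrow> bool" where
  "complete_bipartite_hypergraph r X Y E \<longleftrightarrow>
     2 \<le> r \<and> finite X \<and> finite Y \<and> X \<noteq> {} \<and> Y \<noteq> {} \<and> X \<inter> Y = {} \<and>
     E = {e. e \<subseteq> X \<union> Y \<and> card e = r \<and> e \<inter> X \<noteq> {} \<and> e \<inter> Y \<noteq> {}}"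

lemma complete_bipartite_hypergraph_imp_hypergraph:
  "complete_bipartite_hypergraph r X Y E \<Longrightarrow> hypergraph (X \<union> Y) E \<and> uniform r E"
  by (auto simp: complete_bipartite_hypergraph_def hypergraph_def uniform_def)

definition edge_adjacent :: "'a set \<Rightarrow> 'a set \<Rightarrow> bool" where
  "edge_adjacent e f \<longleftrightarrow> e \<noteq> f \<and> e \<inter> f \<noteq> {}"

definition total_edge_dominating :: "'a set set \<Rightarrow> 'a set set \<Rightarrow> bool" where
  "total_edge_dominating E D \<longleftrightarrow> D \<subseteq> E \<and> (\<forall>e\<in>E. \<exists>f\<in>D. edge_adjacent e f)"

text \<open>
  The maximum is over a finite set whenever \<open>E\<close> is finite. It is only meaningful if \<open>E\<close> admits a
  partition into total edge-dominating sets, i.e. if no hyperedge is isolated.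
\<close>

definition total_edge_domatic_number :: "'a set set \<Rightarrow> nat" where
  "total_edge_domatic_number E =
     Max {card P | P. partition_on E P \<and> (\<forall>D\<in>P. total_edge_dominating E D)}"

end

theory Submission
  imports Defs
begin

text \<open>
  On \<open>2r\<close> vertices an \<open>r\<close>-set is disjoint from exactly one other \<open>r\<close>-set, its complement, and
  \<open>E\<close> is closed under complements. Hence two distinct, non-complementary edges already form a
  total edge-dominating set, while a total edge-dominating set obviously has at least two edges.
  It remains to split \<open>E\<close> into intersecting pairs: if \<open>A\<close> is the set of edges through a fixed
  vertex and \<open>\<sigma>\<close> a fixed-point-free permutation of \<open>A\<close>, pair every \<open>a \<in> A\<close> with the complement
  of \<open>\<sigma> a\<close>.
\<close>

lemma exists_fixed_point_free_permutation:
  assumes "finite A" and "2 \<le> card A"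
  shows "\<exists>\<sigma>. bij_betw \<sigma> A A \<and> (\<forall>a\<in>A. \<sigma> a \<noteq> a)"
proof -
  define m where "m = card A"
  have m: "2 \<le> m" using assms m_def by simp
  obtain h where h: "bij_betw h {0..<m} A"
    using ex_bij_betw_nat_finite[OF assms(1)] m_def by blast
  \<comment> \<open>The cyclic successor on \<open>{0..<m}\<close>, transported to \<open>A\<close>
    along the enumeration \<open>h\<close>. Since m is at least 2, the wrap-around from m - 1 to 0
    moves its argument too.\<close>
  define s where "s i = (if Suc i = m then 0 else Suc i)" for i
  have "s ` {0..<m} \<subseteq> {0..<m}" "inj_on s {0..<m}"
    using m by (auto simp: s_def inj_on_def split: if_splits)
  then have s: "bij_betw s {0..<m} {0..<m}"
    by (simp add: bij_betw_def endo_inj_surj)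
  define g where "g = the_inv_into {0..<m} h"
  have g: "bij_betw g A {0..<m}"
    unfolding g_def by (rule bij_betw_the_inv_into[OF h])
  have "bij_betw (h \<circ> s \<circ> g) A A"
    using bij_betw_trans[OF g bij_betw_trans[OF s h]] by (simp add: comp_assoc)
  moreover have "(h \<circ> s \<circ> g) a \<noteq> a" if "a \<in> A" for a
  proof
    assume eq: "(h \<circ> s \<circ> g) a = a"
    have ga: "g a \<in> {0..<m}" using g that by (auto dest: bij_betwE)
    have "h (g a) = a"
      unfolding g_def using h that by (auto simp: bij_betw_def intro: f_the_inv_into_f)
    with eq have "h (s (g a)) = h (g a)" by simp
    moreover have "s (g a) \<in> {0..<m}" using s ga by (auto dest: bij_betwE)
    ultimately have "s (g a) = g a"
      using h ga by (auto simp: bij_betw_def dest: inj_onD)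
    then show False using m by (auto simp: s_def split: if_splits)
  qed
  ultimately show ?thesis by blast
qed

text \<open>Members of \<open>D\<close> are themselves edges, so each must be dominated from within
  \<open>D\<close>; adjacency is irreflexive, which forces a second member.\<close>

lemma total_edge_dominating_card_ge_2:
  assumes "total_edge_dominating E D" and "D \<noteq> {}" and "finite D"
  shows "2 \<le> card D"
proof -
  obtain f g where "f \<in> D" "g \<in> D" "f \<noteq> g"
    using assms unfolding total_edge_dominating_def edge_adjacent_def by blast
  then have "card {f, g} \<le> card D" using assms(3) by (intro card_mono) auto
  with \<open>f \<noteq> g\<close> show ?thesis by simp
qed

text \<open>The upper bound: the classes are disjoint, nonempty, and of size at least 2 each, so
  summing their sizes counts E.\<close>

lemma total_edge_dominating_partition_card_le:
  assumes "finite E" and "partition_on E P" and "\<forall>D\<in>P. total_edge_dominating E D"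
  shows "2 * card P \<le> card E"
proof -
  have sub: "D \<subseteq> E" "D \<noteq> {}" if "D \<in> P" for D
    using assms(2) that by (auto simp: partition_on_def)
  have fin: "finite D" if "D \<in> P" for D
    using sub that assms(1) finite_subset by blast
  have "2 * card P = (\<Sum>D\<in>P. 2)" by simp
  also have "\<dots> \<le> (\<Sum>D\<in>P. card D)"
    using assms(3) sub fin by (intro sum_mono total_edge_dominating_card_ge_2) auto
  also have "\<dots> = card (\<Union>P)"
    using partition_onD2[OF assms(2)] fin by (intro card_Union_disjoint[symmetric])
  also have "\<Union>P = E" using partition_onD1[OF assms(2)] by simp
  finally show ?thesis .
qed

lemma disjoint_half_eq_compl:
  assumes "finite V" "card V = 2 * r" "e \<subseteq> V" "f \<subseteq> V" "card e = r" "card f = r" "e \<inter> f = {}"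
  shows "f = V - e"
proof (rule card_subset_eq)
  show "card f = card (V - e)"
    using assms by (simp add: card_Diff_subset finite_subset)
qed (use assms in auto)

text \<open>The two edges dominate each other. A third edge missing both would have both as its
  complement, although they are distinct.\<close>

lemma intersecting_pair_total_edge_dominating:
  assumes V: "finite V" "card V = 2 * r" and E: "\<forall>e\<in>E. e \<subseteq> V \<and> card e = r"
    and "e \<in> E" "f \<in> E" "edge_adjacent e f"
  shows "total_edge_dominating E {e, f}"
  unfolding total_edge_dominating_def
proof (intro conjI ballI)
  fix g assume g: "g \<in> E"
  show "\<exists>h\<in>{e, f}. edge_adjacent g h"
  proof (cases "g = e \<or> g = f")
    case True
    with assms(6) show ?thesis by (auto simp: edge_adjacent_def)
  next
    case False
    have "g \<inter> e \<noteq> {} \<or> g \<inter> f \<noteq> {}"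
    proof (rule ccontr)
      assume "\<not> ?thesis"
      then have "e = V - g" "f = V - g"
        using disjoint_half_eq_compl[OF V, of g] E g assms(4,5) by blast+
      with assms(6) show False by (simp add: edge_adjacent_def)
    qed
    with False show ?thesis by (auto simp: edge_adjacent_def)
  qed
qed (use assms in auto)

text \<open>The lower bound, isolated from the bipartite structure: only closure under complements
  and a vertex of degree at least 2 enter.\<close>

lemma complement_closed_intersecting_pairs:
  assumes V: "finite V" "card V = 2 * r"
    and E: "\<forall>e\<in>E. e \<subseteq> V \<and> card e = r"
    and compl: "\<forall>e\<in>E. V - e \<in> E"
    and x: "x \<in> V" and two: "2 \<le> card {e \<in> E. x \<in> e}"
  shows "\<exists>P. partition_on E P \<and> (\<forall>D\<in>P. total_edge_dominating E D) \<and> 2 * card P = card E"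
proof -
  define A where "A = {e \<in> E. x \<in> e}"
  have finE: "finite E"
    using V E by (intro finite_subset[of E "Pow V"]) auto
  then have finA: "finite A" by (simp add: A_def)
  \<comment> \<open>Exactly one edge of each complementary pair contains x, so \<open>A\<close> is a
    set of representatives and has half the size of E.\<close>
  have AE: "E = A \<union> (\<lambda>e. V - e) ` A"
  proof
    show "E \<subseteq> A \<union> (\<lambda>e. V - e) ` A"
    proof
      fix e assume e: "e \<in> E"
      show "e \<in> A \<union> (\<lambda>e. V - e) ` A"
      proof (cases "x \<in> e")
        case False
        with e x compl have "V - e \<in> A" by (auto simp: A_def)
        moreover have "e = V - (V - e)" using e E by blast
        ultimately show ?thesis by blast
      qed (use e A_def in auto)
    qed
  qed (use compl A_def in auto)
  have injc: "inj_on (\<lambda>e. V - e) A"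
    using E by (intro inj_on_inverseI[where g = "\<lambda>e. V - e"]) (auto simp: A_def double_diff)
  have "card E = card A + card ((\<lambda>e. V - e) ` A)"
    by (subst AE, rule card_Un_disjoint) (use finA in \<open>auto simp: A_def\<close>)
  then have cardE: "card E = 2 * card A"
    using injc by (simp add: card_image)
  obtain \<sigma> where bij: "bij_betw \<sigma> A A" and fpf: "\<And>a. a \<in> A \<Longrightarrow> \<sigma> a \<noteq> a"
    using exists_fixed_point_free_permutation[OF finA] two A_def by auto
  have \<sigma>A: "\<sigma> a \<in> A" if "a \<in> A" for a using bij that by (auto dest: bij_betwE)
  define p where "p a = {a, V - \<sigma> a}" for a
  have x_in: "x \<in> a" "x \<notin> V - \<sigma> a" if "a \<in> A" for a
    using that \<sigma>A[OF that] by (auto simp: A_def)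
  \<comment> \<open>The vertex x separates the two kinds of members, so a common member would need a
    = b or equal complements; the latter is excluded by injectivity of \<sigma> and of
    complementation.\<close>
  have p_disj: "p a \<inter> p b = {}" if ab: "a \<in> A" "b \<in> A" "a \<noteq> b" for a b
  proof -
    have "\<sigma> a \<noteq> \<sigma> b" using bij ab by (auto simp: bij_betw_def dest: inj_onD)
    then have "V - \<sigma> a \<noteq> V - \<sigma> b" using inj_onD[OF injc] \<sigma>A ab by blast
    then show ?thesis using x_in[OF ab(1)] x_in[OF ab(2)] ab(3) by (auto simp: p_def)
  qed
  have "inj_on p A"
    using p_disj by (intro inj_onI) (metis Int_absorb insert_not_empty p_def)
  then have "card (p ` A) = card A" by (rule card_image)
  moreover have "partition_on E (p ` A)"
  proof (rule partition_onI)
    have "\<Union>(p ` A) = A \<union> (\<lambda>e. V - e) ` (\<sigma> ` A)" by (auto simp: p_def)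
    also have "\<sigma> ` A = A" using bij by (simp add: bij_betw_def)
    finally show "\<Union>(p ` A) = E" using AE by simp
    show "disjnt D D'" if "D \<in> p ` A" "D' \<in> p ` A" "D \<noteq> D'" for D D'
      using that p_disj unfolding disjnt_def by blast
  qed (auto simp: p_def)
  moreover have "total_edge_dominating E (p a)" if a: "a \<in> A" for a
    unfolding p_def
  proof (rule intersecting_pair_total_edge_dominating[OF V E])
    show aE: "a \<in> E" and "V - \<sigma> a \<in> E" using a \<sigma>A compl by (auto simp: A_def)
    have \<sigma>E: "\<sigma> a \<in> E" using a \<sigma>A by (auto simp: A_def)
    \<comment> \<open>Both sets have size r, so inclusion would mean equality. A point of a outside
      \<sigma> a is a common point of a and V - \<sigma> a.\<close>
    have "\<not> a \<subseteq> \<sigma> a"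
      using fpf[OF a] card_subset_eq[of "\<sigma> a" a] E aE \<sigma>E V finite_subset by metis
    then show "edge_adjacent a (V - \<sigma> a)"
      using E aE x_in[OF a] by (auto simp: edge_adjacent_def)
  qed
  ultimately show ?thesis using cardE by (intro exI[of _ "p ` A"]) auto
qed

text \<open>If the complement missed X, then e would contain X and, having the same size, equal it,
  contradicting that e meets Y; symmetrically for Y.\<close>

lemma complete_bipartite_hypergraph_compl_closed:
  assumes "complete_bipartite_hypergraph r X Y E" "card X = r" "card Y = r" "e \<in> E"
  shows "X \<union> Y - e \<in> E"
proof -
  have fin: "finite X" "finite Y" and disj: "X \<inter> Y = {}"
    and e: "e \<subseteq> X \<union> Y" "card e = r" "e \<inter> X \<noteq> {}" "e \<inter> Y \<noteq> {}"
    and E: "E = {e. e \<subseteq> X \<union> Y \<and> card e = r \<and> e \<inter> X \<noteq> {} \<and> e \<inter> Y \<noteq> {}}"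
    using assms by (auto simp: complete_bipartite_hypergraph_def)
  have fine: "finite e" using e fin finite_subset by blast
  have "\<not> X \<subseteq> e" "\<not> Y \<subseteq> e"
    using card_subset_eq[OF fine, of X] card_subset_eq[OF fine, of Y] assms(2,3) e disj by auto
  moreover have "card (X \<union> Y - e) = r"
    using fin disj e fine assms(2,3) by (simp add: card_Diff_subset card_Un_disjoint)
  ultimately show ?thesis unfolding E by auto
qed

lemma complete_bipartite_hypergraph_degree_ge_2:
  assumes "complete_bipartite_hypergraph r X Y E" "card Y = r" "x \<in> X"
  shows "2 \<le> card {e \<in> E. x \<in> e}"
proof -
  have r: "2 \<le> r" and fin: "finite X" "finite Y" and disj: "X \<inter> Y = {}"
    and E: "E = {e. e \<subseteq> X \<union> Y \<and> card e = r \<and> e \<inter> X \<noteq> {} \<and> e \<inter> Y \<noteq> {}}"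
    using assms by (auto simp: complete_bipartite_hypergraph_def)
  \<comment> \<open>Exchanging one vertex y of Y for x yields r different edges through x. They
    still meet Y because r is at least 2.\<close>
  define q where "q y = insert x (Y - {y})" for y
  have xY: "x \<notin> Y" using disj assms(3) by blast
  have "inj_on q Y"
  proof (rule inj_onI, rule ccontr)
    fix y z assume "y \<in> Y" "z \<in> Y" "q y = q z" "y \<noteq> z"
    then have "y \<in> q y" by (simp add: q_def)
    with \<open>y \<in> Y\<close> xY show False by (auto simp: q_def)
  qed
  then have "card (q ` Y) = r" using assms(2) by (simp add: card_image)
  moreover have "q ` Y \<subseteq> {e \<in> E. x \<in> e}"
  proof
    fix e assume "e \<in> q ` Y"
    then obtain y where y: "y \<in> Y" "e = insert x (Y - {y})" by (auto simp: q_def)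
    have c: "card (Y - {y}) = r - 1" using y assms(2) fin by simp
    then have "Y - {y} \<noteq> {}" using r by fastforce
    moreover have "card e = r" using y c xY fin r by simp
    ultimately show "e \<in> {e \<in> E. x \<in> e}" using y assms(3) unfolding E by auto
  qed
  moreover have "finite {e \<in> E. x \<in> e}"
    using fin by (auto simp: E)
  ultimately have "r \<le> card {e \<in> E. x \<in> e}" using card_mono by metis
  with r show ?thesis by simp
qed

theorem theorem10:
  fixes X Y :: "'a set" and E :: "'a set set" and r :: nat
  assumes "complete_bipartite_hypergraph r X Y E"
    and "card X = r" and "card Y = r"
  shows "real (total_edge_domatic_number E) = real (card E) / 2"
proof -
  have fin: "finite X" "finite Y" and disj: "X \<inter> Y = {}" and "X \<noteq> {}"
    and E: "\<forall>e\<in>E. e \<subseteq> X \<union> Y \<and> card e = r"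
    using assms(1) by (auto simp: complete_bipartite_hypergraph_def)
  then obtain x where x: "x \<in> X" by blast
  have finE: "finite E"
    using fin E by (intro finite_subset[of E "Pow (X \<union> Y)"]) auto
  have "\<exists>P. partition_on E P \<and> (\<forall>D\<in>P. total_edge_dominating E D) \<and> 2 * card P = card E"
  proof (rule complement_closed_intersecting_pairs[OF _ _ E, where x = x])
    show "card (X \<union> Y) = 2 * r" using fin disj assms by (simp add: card_Un_disjoint)
    show "2 \<le> card {e \<in> E. x \<in> e}"
      by (rule complete_bipartite_hypergraph_degree_ge_2[OF assms(1,3) x])
  qed (use fin x complete_bipartite_hypergraph_compl_closed[OF assms] in auto)
  then obtain P where P: "partition_on E P" "\<forall>D\<in>P. total_edge_dominating E D" "2 * card P = card E"
    by blast
  let ?S = "{card P | P. partition_on E P \<and> (\<forall>D\<in>P. total_edge_dominating E D)}"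
  have le: "n \<le> card P" if "n \<in> ?S" for n
  proof -
    obtain Q where "partition_on E Q" "\<forall>D\<in>Q. total_edge_dominating E D" "n = card Q"
      using \<open>n \<in> ?S\<close> by blast
    with total_edge_dominating_partition_card_le[OF finE this(1,2)] P(3) show ?thesis by simp
  qed
  \<comment> \<open>\<open>Max\<close> is only meaningful on a finite set; the upper bound on class
    counts supplies finiteness.\<close>
  have "?S \<subseteq> {..card P}" using le by blast
  then have "finite ?S" using finite_subset by blast
  moreover have "card P \<in> ?S" using P by blast
  ultimately have "Max ?S = card P" using le by (intro Max_eqI)
  then show ?thesis using P(3) by (simp add: total_edge_domatic_number_def)
qed

end
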